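(* Let $0\le q<\infty$ be an integer, let $X=C^q(\mathbb{R})$ be endowed with the topology defined below, and let $Y$ be a real linear topological space. Every bounded-differentiable germ at $0\in C^q(\mathbb{R})$ of maps from $X$ to $Y$ has a global bounded-differentiable representative, and every compact-differentiable germ at $0\in C^q(\mathbb{R})$ of maps from $X$ to $Y$ has a global compact-differentiable representative.
   Context: $C^q(\mathbb{R})$ is the space of all $q$ times continuously differentiable real functions on $\mathbb{R}$, with the topology defined by the collection $\|x\|_k=\max_{t\in[-k,k]}\max_{l\le q}|x^{(l)}(t)|$, $k=0,1,2,\dots$ Germs: two maps into $Y$ defined on neighborhoods of $0\in X$ are equivalent if they coincide on some neighborhood of $0$; a germ at $0$ is an equivalence class, and its members are its representatives. A representative is global if it is defined on all of $X$. A germ is bounded- (resp. compact-) differentiable if it has a representative that is so at every point of its (open) domain; a global representative is bounded- (resp. compact-) differentiable if it is so at every point of $X$. A map $f$ is bounded-differentiable at $x$ if there is a continuous linear operator $A:X\to Y$ such that for every bounded subset $S\subset X$, for $h\in S$ and $t\in\mathbb{R}$, $f(x+th)-f(x)=tAh+r(th)$ with $r(th)/t\to0$ uniformly in $h\in S$ as $t\to0$. It is compact (Hadamard) differentiable at $x$ if there is a continuous linear operator $A:X\to Y$ such that $f(x+t_nh_n)-f(x)=t_nAh+o(t_n)$ whenever $t_n\to0$ in $\mathbb{R}$ and $h_n\to h$ in $X$. *)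

theory Defs
  imports "HOL-Analysis.Analysis" "HOL-Library.Function_Algebras"
begin

instantiation "fun" :: (type, real_vector) real_vector
begin

definition scaleR_fun :: "real \<Rightarrow> ('a \<Rightarrow> 'b) \<Rightarrow> 'a \<Rightarrow> 'b" where
  "scaleR_fun c f = (\<lambda>x. c *\<^sub>R f x)"

instance
  by standard (auto simp: scaleR_fun_def fun_eq_iff scaleR_add_right scaleR_add_left)

end

text \<open>Real linear topological spaces; as the Hausdorff property is not part of the notion, it is
  not assumed.\<close>

class real_tvs = real_vector + topological_ab_group_add +
  assumes tendsto_scaleR_Pair:
    "LIM p (nhds (a::real) \<times>\<^sub>F nhds b). fst p *\<^sub>R snd p :> nhds (a *\<^sub>R b)"


section \<open>The space of \<open>q\<close> times continuously differentiable functions\<close>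

definition Cq :: "nat \<Rightarrow> (real \<Rightarrow> real) set" where
  "Cq q = {x. (\<forall>l<q. \<forall>t. (deriv ^^ l) x differentiable (at t)) \<and>
              continuous_on UNIV ((deriv ^^ q) x)}"

text \<open>On \<^term>\<open>Cq q\<close> the supremum is attained, by compactness of the interval, so it is a maximum.\<close>

definition Cq_seminorm :: "nat \<Rightarrow> nat \<Rightarrow> (real \<Rightarrow> real) \<Rightarrow> real" where
  "Cq_seminorm q k x =
     (SUP t\<in>{- real k .. real k}. Max ((\<lambda>l. \<bar>(deriv ^^ l) x t\<bar>) ` {..q}))"

definition Cq_topology :: "nat \<Rightarrow> (real \<Rightarrow> real) topology" where
  "Cq_topology q = topology_generated_by
     {{y \<in> Cq q. Cq_seminorm q k (y - x) < e} | x k e. x \<in> Cq q \<and> 0 < e}"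

lemma topspace_Cq_topology: "topspace (Cq_topology q) = Cq q"
proof -
  have "x \<in> topspace (Cq_topology q)" if "x \<in> Cq q" for x
  proof -
    define e where "e = \<bar>Cq_seminorm q 0 (x - x)\<bar> + 1"
    have "0 < e" "x \<in> {y \<in> Cq q. Cq_seminorm q 0 (y - x) < e}"
      using that unfolding e_def by auto
    then show ?thesis
      unfolding Cq_topology_def topology_generated_by_topspace using that by blast
  qed
  then show ?thesis
    unfolding Cq_topology_def topology_generated_by_topspace by blast
qed


section \<open>Differentiability\<close>

text \<open>In the following, the space \<open>X\<close> is the linear subspace \<^term>\<open>topspace T\<close> of the ambient
  vector space, with the topology \<open>T\<close>; the type class topology (if any) of the ambient space plays
  no role.\<close>

definition tvs_bounded :: "'a::real_vector topology \<Rightarrow> 'a set \<Rightarrow> bool" where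
  "tvs_bounded T S \<longleftrightarrow> S \<subseteq> topspace T \<and>
     (\<forall>V. openin T V \<and> 0 \<in> V \<longrightarrow> (\<exists>r>0. \<forall>c>r. S \<subseteq> (\<lambda>v. c *\<^sub>R v) ` V))"

definition continuous_linear_operator ::
    "'a::real_vector topology \<Rightarrow> ('a \<Rightarrow> 'b::real_tvs) \<Rightarrow> bool" where
  "continuous_linear_operator T A \<longleftrightarrow>
     continuous_map T euclidean A \<and>
     (\<forall>x\<in>topspace T. \<forall>y\<in>topspace T. A (x + y) = A x + A y) \<and>
     (\<forall>c. \<forall>x\<in>topspace T. A (c *\<^sub>R x) = c *\<^sub>R A x)"

text \<open>Maps defined on subsets of \<open>X\<close> are partial functions. The two notions of differentiability
  at \<open>x\<close> are meant for \<open>x\<close> in the interior of the domain; then the arguments below lie in the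
  domain for all small \<open>t\<close> (uniformly in \<open>h \<in> S\<close>) and for all large \<open>n\<close>, respectively, so that
  unspecified values are irrelevant. In the second definition, the remainder vanishes whenever
  \<open>t n = 0\<close>, in accordance with \<^term>\<open>inverse (0::real) = 0\<close>.\<close>

definition bounded_differentiable_at ::
    "'a::real_vector topology \<Rightarrow> ('a \<rightharpoonup> 'b::real_tvs) \<Rightarrow> 'a \<Rightarrow> bool" where
  "bounded_differentiable_at T f x \<longleftrightarrow>
     (\<exists>A. continuous_linear_operator T A \<and>
       (\<forall>S. tvs_bounded T S \<longrightarrow>
         (\<forall>V. open V \<and> 0 \<in> V \<longrightarrow>
           (\<forall>\<^sub>F t::real in at 0. \<forall>h\<in>S.
              (the (f (x + t *\<^sub>R h)) - the (f x) - t *\<^sub>R A h) /\<^sub>R t \<in> V))))"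

definition compact_differentiable_at ::
    "'a::real_vector topology \<Rightarrow> ('a \<rightharpoonup> 'b::real_tvs) \<Rightarrow> 'a \<Rightarrow> bool" where
  "compact_differentiable_at T f x \<longleftrightarrow>
     (\<exists>A. continuous_linear_operator T A \<and>
       (\<forall>(t :: nat \<Rightarrow> real) h h0.
         t \<longlonglongrightarrow> 0 \<and> range h \<subseteq> topspace T \<and> limitin T h h0 sequentially \<longrightarrow>
         (\<lambda>n. (the (f (x + t n *\<^sub>R h n)) - the (f x) - t n *\<^sub>R A h0) /\<^sub>R t n) \<longlonglongrightarrow> 0))"


section \<open>Germs at the origin\<close>

definition local_maps :: "'a::real_vector topology \<Rightarrow> ('a \<rightharpoonup> 'b) set" where
  "local_maps T = {f. dom f \<subseteq> topspace T \<and> (\<exists>U. openin T U \<and> 0 \<in> U \<and> U \<subseteq> dom f)}"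

definition germ_rel :: "'a::real_vector topology \<Rightarrow> (('a \<rightharpoonup> 'b) \<times> ('a \<rightharpoonup> 'b)) set" where
  "germ_rel T = {(f, g). f \<in> local_maps T \<and> g \<in> local_maps T \<and>
     (\<exists>U. openin T U \<and> 0 \<in> U \<and> U \<subseteq> dom f \<inter> dom g \<and> (\<forall>x\<in>U. f x = g x))}"

definition germs :: "'a::real_vector topology \<Rightarrow> ('a \<rightharpoonup> 'b) set set" where
  "germs T = local_maps T // germ_rel T"

definition bounded_differentiable_germ ::
    "'a::real_vector topology \<Rightarrow> ('a \<rightharpoonup> 'b::real_tvs) set \<Rightarrow> bool" where
  "bounded_differentiable_germ T G \<longleftrightarrow>
     (\<exists>f\<in>G. openin T (dom f) \<and> (\<forall>x\<in>dom f. bounded_differentiable_at T f x))"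

definition compact_differentiable_germ ::
    "'a::real_vector topology \<Rightarrow> ('a \<rightharpoonup> 'b::real_tvs) set \<Rightarrow> bool" where
  "compact_differentiable_germ T G \<longleftrightarrow>
     (\<exists>f\<in>G. openin T (dom f) \<and> (\<forall>x\<in>dom f. compact_differentiable_at T f x))"

definition global_representative ::
    "'a::real_vector topology \<Rightarrow> ('a \<rightharpoonup> 'b) set \<Rightarrow> ('a \<rightharpoonup> 'b) \<Rightarrow> bool" where
  "global_representative T G f \<longleftrightarrow> f \<in> G \<and> dom f = topspace T"

end

theory Submission
  imports Defs
begin

text \<open>A representative \<open>f\<close> of the germ is defined on some seminorm ball
  \<open>{x. \<parallel>x\<parallel>\<^sub>k < e}\<close>. It suffices to find a differentiable map \<open>H\<close> of \<open>C\<^sup>q\<close> into this ball that is the identity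
  on a smaller ball: then \<open>f \<circ> H\<close> is a global representative, and differentiability passes to it by
  the chain rule.

  Such an \<open>H\<close> is obtained by truncating the values of \<open>x\<close> instead of its norm. An element of \<open>C\<^sup>q\<close>
  is given freely by the numbers \<open>x\<^sup>(\<^sup>l\<^sup>)(0)\<close>, \<open>l < q\<close>, and the continuous function
  \<open>x\<^sup>(\<^sup>q\<^sup>)\<close> (lemma \<open>Cq_exists_with_taylor_data\<close>), and the size of these data on \<open>[-r, r]\<close> controls all
  derivatives up to order \<open>q\<close> there (lemma \<open>jet_bound_from_taylor_data\<close>). So one applies to each
  of these data a scalar function \<open>u \<mapsto> u + \<theta> u\<close> that is the identity near \<open>0\<close> and has a small
  bounded range. Only values on \<open>[-k, k]\<close> are small when \<open>\<parallel>x\<parallel>\<^sub>k\<close> is; in order that \<open>H\<close> be the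
  identity on a whole ball, the correction \<open>\<theta>\<close> is evaluated on \<open>[-k, k]\<close> only and continued as a
  constant:
  \<open>(H x)\<^sup>(\<^sup>q\<^sup>)(t) = x\<^sup>(\<^sup>q\<^sup>)(t) + \<theta> (x\<^sup>(\<^sup>q\<^sup>)(s))\<close>, where \<open>s\<close> is the point of \<open>[-k, k]\<close> nearest to \<open>t\<close>.

  Since \<open>\<theta>\<close> is Lipschitz and has a Lipschitz derivative, the difference quotients of \<open>H\<close> are bounded
  by a multiple of \<open>\<parallel>h\<parallel>\<^sub>m\<close> in every seminorm and differ from the derivative by
  \<open>O(\<bar>t\<bar> \<parallel>h\<parallel>\<^sub>m\<^sup>2)\<close> (lemmas \<open>seminorm_diff_quotient_truncate\<close> and
  \<open>seminorm_truncate_remainder\<close>). These two estimates give the hypotheses of the chain rule for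
  both notions of differentiability.\<close>


section \<open>Derivatives of functions in \<open>C\<^sup>q\<close>\<close>

lemma Cq_has_derivative:
  assumes "x \<in> Cq q" "l < q"
  shows "((deriv ^^ l) x has_real_derivative (deriv ^^ Suc l) x t) (at t)"
  using assms by (simp add: Cq_def DERIV_deriv_iff_real_differentiable)

lemma Cq_continuous_deriv:
  assumes "x \<in> Cq q" "l \<le> q"
  shows "continuous_on S ((deriv ^^ l) x)"
proof (cases "l = q")
  case True
  then show ?thesis
    using assms by (auto simp: Cq_def intro: continuous_on_subset)
next
  case False
  then have "isCont ((deriv ^^ l) x) t" for t
    using assms Cq_has_derivative[of x q l t] by (auto dest: DERIV_isCont)
  then show ?thesis
    by (auto intro: continuous_at_imp_continuous_on)
qed

lemma higher_deriv_lincomb: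
  assumes "x \<in> Cq q" "y \<in> Cq q" "l \<le> q"
  shows "(deriv ^^ l) (a *\<^sub>R x + b *\<^sub>R y) = (\<lambda>t. a * (deriv ^^ l) x t + b * (deriv ^^ l) y t)"
  using assms(3)
proof (induction l)
  case 0
  then show ?case by (auto simp: scaleR_fun_def)
next
  case (Suc l)
  have "((\<lambda>t. a * (deriv ^^ l) x t + b * (deriv ^^ l) y t) has_real_derivative
      a * (deriv ^^ Suc l) x t + b * (deriv ^^ Suc l) y t) (at t)" for t
    using Suc.prems assms
    by (intro DERIV_add DERIV_cmult Cq_has_derivative) auto
  then have "deriv (\<lambda>t. a * (deriv ^^ l) x t + b * (deriv ^^ l) y t) t =
      a * (deriv ^^ Suc l) x t + b * (deriv ^^ Suc l) y t" for t
    by (rule DERIV_imp_deriv)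
  then have "deriv (\<lambda>t. a * (deriv ^^ l) x t + b * (deriv ^^ l) y t) =
      (\<lambda>t. a * (deriv ^^ Suc l) x t + b * (deriv ^^ Suc l) y t)" ..
  then show ?case
    using Suc by simp
qed

lemma Cq_lincomb:
  assumes "x \<in> Cq q" "y \<in> Cq q"
  shows "a *\<^sub>R x + b *\<^sub>R y \<in> Cq q"
proof -
  have "(deriv ^^ l) (a *\<^sub>R x + b *\<^sub>R y) differentiable (at t)" if "l < q" for l t
  proof -
    have "((\<lambda>t. a * (deriv ^^ l) x t + b * (deriv ^^ l) y t) has_real_derivative
      a * (deriv ^^ Suc l) x t + b * (deriv ^^ Suc l) y t) (at t)"
      using that assms by (intro DERIV_add DERIV_cmult Cq_has_derivative) auto
    then show ?thesis
      using that assms by (auto simp: higher_deriv_lincomb real_differentiable_def)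
  qed
  moreover have "continuous_on UNIV ((deriv ^^ q) (a *\<^sub>R x + b *\<^sub>R y))"
    using assms by (auto simp: higher_deriv_lincomb intro!: continuous_intros Cq_continuous_deriv)
  ultimately show ?thesis
    by (simp add: Cq_def)
qed

lemma zero_in_Cq: "0 \<in> Cq q"
proof -
  have "(deriv ^^ l) (0 :: real \<Rightarrow> real) = 0" for l
    by (induction l) (auto simp: zero_fun_def)
  then show ?thesis
    by (simp add: Cq_def zero_fun_def)
qed

lemma Cq_scaleR: "x \<in> Cq q \<Longrightarrow> c *\<^sub>R x \<in> Cq q"
  using Cq_lincomb[of x q x c 0] by simp

lemma Cq_add: "x \<in> Cq q \<Longrightarrow> y \<in> Cq q \<Longrightarrow> x + y \<in> Cq q"
  using Cq_lincomb[of x q y 1 1] by simp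

lemma Cq_diff: "x \<in> Cq q \<Longrightarrow> y \<in> Cq q \<Longrightarrow> x - y \<in> Cq q"
  using Cq_lincomb[of x q y 1 "-1"] by simp

lemma subspace_Cq: "subspace (Cq q)"
  by (simp add: subspace_def zero_in_Cq Cq_add Cq_scaleR)


section \<open>Functions in \<open>C\<^sup>q\<close> from their Taylor data\<close>

text \<open>Derivative and point of evaluation are packed into one argument \<open>(l, t)\<close>, so that the initial
  values and the top derivative of a function can be treated alike.\<close>

definition jet :: "(real \<Rightarrow> real) \<Rightarrow> nat \<times> real \<Rightarrow> real" where
  "jet x p = (deriv ^^ fst p) x (snd p)"

text \<open>The points \<open>(l, t)\<close> at which the values of the jet determine a function in \<open>C\<^sup>q\<close> and can be
  prescribed freely, up to continuity in \<open>t\<close> for \<open>l = q\<close>.\<close>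

definition taylor_points :: "nat \<Rightarrow> (nat \<times> real) set" where
  "taylor_points q = {(l, t). l = q \<or> l < q \<and> t = 0}"

lemma jet_lincomb:
  assumes "x \<in> Cq q" "y \<in> Cq q" "fst p \<le> q"
  shows "jet (a *\<^sub>R x + b *\<^sub>R y) p = a * jet x p + b * jet y p"
  using assms by (simp add: jet_def higher_deriv_lincomb)

lemma jet_scaleR: "x \<in> Cq q \<Longrightarrow> fst p \<le> q \<Longrightarrow> jet (c *\<^sub>R x) p = c * jet x p"
  using jet_lincomb[of x q x p c 0] by simp

lemma jet_add: "x \<in> Cq q \<Longrightarrow> y \<in> Cq q \<Longrightarrow> fst p \<le> q \<Longrightarrow> jet (x + y) p = jet x p + jet y p"
  using jet_lincomb[of x q y p 1 1] by simp

lemma jet_diff: "x \<in> Cq q \<Longrightarrow> y \<in> Cq q \<Longrightarrow> fst p \<le> q \<Longrightarrow> jet (x - y) p = jet x p - jet y p"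
  using jet_lincomb[of x q y p 1 "-1"] by simp

lemma taylor_points_le: "p \<in> taylor_points q \<Longrightarrow> fst p \<le> q"
  by (auto simp: taylor_points_def)

lemma continuous_antiderivative:
  fixes g :: "real \<Rightarrow> real"
  assumes "continuous_on UNIV g"
  obtains G where "\<And>t. (G has_real_derivative g t) (at t)" "G 0 = c"
proof -
  have "\<exists>F. \<forall>t. -\<infinity> < ereal t \<longrightarrow> ereal t < \<infinity> \<longrightarrow> (F has_vector_derivative g t) (at t)"
    using assms by (intro einterval_antiderivative) (auto simp: continuous_on_eq_continuous_at)
  then obtain F where "\<And>t. (F has_real_derivative g t) (at t)"
    by (auto simp: has_real_derivative_iff_has_vector_derivative)
  then have "((\<lambda>t. F t - F 0 + c) has_real_derivative g t) (at t)" for t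
    by (auto intro!: derivative_eq_intros)
  then show thesis
    by (rule that) simp
qed

text \<open>Integrate the top derivative \<open>q\<close> times, each time with the prescribed value at \<open>0\<close> as constant
  of integration.\<close>

lemma Cq_exists_with_taylor_data:
  assumes "continuous_on UNIV (\<lambda>t. w (q, t))"
  shows "\<exists>z\<in>Cq q. \<forall>p\<in>taylor_points q. jet z p = w p"
proof -
  have "\<exists>z\<in>Cq q. (\<forall>l<q. (deriv ^^ l) z 0 = c l) \<and> (deriv ^^ q) z = g"
    if "continuous_on UNIV g" for c and g :: "real \<Rightarrow> real"
    using that
  proof (induction q arbitrary: c)
    case 0
    then show ?case by (auto simp: Cq_def)
  next
    case (Suc q)
    obtain w where w: "w \<in> Cq q" "\<And>l. l < q \<Longrightarrow> (deriv ^^ l) w 0 = c (Suc l)" "(deriv ^^ q) w = g"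
      using Suc.IH[OF Suc.prems, of "\<lambda>l. c (Suc l)"] by auto
    have "continuous_on UNIV w"
      using Cq_continuous_deriv[OF w(1), of 0] by simp
    then obtain z where z: "\<And>t. (z has_real_derivative w t) (at t)" "z 0 = c 0"
      using continuous_antiderivative by blast
    then have dz: "deriv z = w"
      by (auto simp: fun_eq_iff intro: DERIV_imp_deriv)
    have higher: "(deriv ^^ Suc l) z = (deriv ^^ l) w" for l
      by (simp add: funpow_Suc_right dz del: funpow.simps)
    have "(deriv ^^ l) z differentiable (at t)" if "l < Suc q" for l t
    proof (cases l)
      case 0
      then show ?thesis using z by (auto simp: real_differentiable_def)
    next
      case (Suc l')
      then show ?thesis using that w(1) higher by (auto simp: Cq_def)
    qed
    moreover have "(deriv ^^ l) z 0 = c l" if "l < Suc q" for l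
      using that w(2) z(2) higher by (cases l) auto
    ultimately show ?case
      using Suc.prems w(3) higher[of q] by (intro bexI[of _ z]) (auto simp: Cq_def)
  qed
  from this[OF assms, of "\<lambda>l. w (l, 0)"] show ?thesis
    by (fastforce simp: taylor_points_def jet_def)
qed

text \<open>Descending induction on the order \<open>l\<close>: by the mean value theorem, a bound \<open>B \<ge> b\<close> for the
  derivative of order \<open>l + 1\<close> on \<open>[-r, r]\<close> gives the bound \<open>b + r B \<le> (1 + r) B\<close> for order \<open>l\<close>.\<close>

lemma jet_bound_from_taylor_data:
  assumes z: "z \<in> Cq q" and l: "l \<le> q" and t: "\<bar>t\<bar> \<le> r"
    and b: "\<And>p. p \<in> taylor_points q \<Longrightarrow> \<bar>snd p\<bar> \<le> r \<Longrightarrow> \<bar>jet z p\<bar> \<le> b"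
  shows "\<bar>jet z (l, t)\<bar> \<le> (1 + r) ^ q * b"
proof -
  have r: "0 \<le> r"
    using t by simp
  have "0 \<le> b"
    using b[of "(q, 0)"] r by (simp add: taylor_points_def)
  have "\<bar>jet z (l, t)\<bar> \<le> (1 + r) ^ (q - l) * b"
    using l t
  proof (induction l arbitrary: t rule: inc_induct)
    case base
    then show ?case
      using b[of "(q, t)"] by (simp add: taylor_points_def)
  next
    case (step l)
    define B where "B = (1 + r) ^ (q - Suc l) * b"
    have "b \<le> B"
      using \<open>0 \<le> b\<close> r mult_right_mono[of 1 "(1 + r) ^ (q - Suc l)" b] by (simp add: B_def)
    have "norm ((deriv ^^ l) z t - (deriv ^^ l) z 0) \<le> B * norm (t - 0)"
    proof (rule field_differentiable_bound[where S = "{-r..r}"])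
      show "((deriv ^^ l) z has_field_derivative (deriv ^^ Suc l) z s) (at s within {-r..r})" for s
        using step.hyps z by (auto intro: has_field_derivative_at_within Cq_has_derivative simp del: funpow.simps)
      show "norm ((deriv ^^ Suc l) z s) \<le> B" if "s \<in> {-r..r}" for s
        using step.IH[of s] that by (simp add: jet_def B_def abs_le_iff)
    qed (use step.prems r in auto)
    also have "\<dots> \<le> B * r"
      using step.prems \<open>0 \<le> b\<close> \<open>b \<le> B\<close> by (intro mult_left_mono) auto
    finally have "\<bar>jet z (l, t)\<bar> \<le> b + B * r"
      using b[of "(l, 0)"] step.hyps r by (simp add: jet_def taylor_points_def)
    also have "\<dots> \<le> (1 + r) * B"
      using \<open>b \<le> B\<close> by (simp add: algebra_simps)
    also have "\<dots> = (1 + r) ^ (q - l) * b"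
      using step.hyps by (simp add: B_def Suc_diff_Suc flip: power_Suc)
    finally show ?case .
  qed
  also have "\<dots> \<le> (1 + r) ^ q * b"
    using r \<open>0 \<le> b\<close> by (intro mult_right_mono power_increasing) auto
  finally show ?thesis .
qed

lemma Cq_eqI:
  assumes "x \<in> Cq q" "y \<in> Cq q" "\<And>p. p \<in> taylor_points q \<Longrightarrow> jet x p = jet y p"
  shows "x = y"
proof
  fix t
  have "\<bar>jet (x - y) (0, t)\<bar> \<le> (1 + \<bar>t\<bar>) ^ q * 0"
    using assms by (intro jet_bound_from_taylor_data Cq_diff)
      (auto simp: jet_diff taylor_points_le)
  then show "x t = y t"
    by (simp add: jet_def)
qed


section \<open>The topology of \<open>C\<^sup>q\<close>\<close>

text \<open>All further facts on the seminorms come from this description, which replaces the supremum of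
  maxima by pointwise bounds: by compactness of the interval the values are bounded above, without
  which the supremum would be unspecified.\<close>

lemma Cq_seminorm_le_iff:
  assumes "x \<in> Cq q"
  shows "Cq_seminorm q k x \<le> b \<longleftrightarrow> (\<forall>l\<le>q. \<forall>t. \<bar>t\<bar> \<le> real k \<longrightarrow> \<bar>jet x (l, t)\<bar> \<le> b)"
proof -
  let ?M = "\<lambda>t. Max ((\<lambda>l. \<bar>(deriv ^^ l) x t\<bar>) ` {..q})"
  have "\<exists>B. \<forall>t\<in>{- real k..real k}. \<bar>(deriv ^^ l) x t\<bar> \<le> B" if "l \<le> q" for l
  proof -
    have "compact ((deriv ^^ l) x ` {- real k..real k})"
      using assms that by (intro compact_continuous_image Cq_continuous_deriv) auto
    then show ?thesis
      by (auto dest!: compact_imp_bounded simp: bounded_iff)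
  qed
  then obtain B where B: "\<And>l t. l \<le> q \<Longrightarrow> t \<in> {- real k..real k} \<Longrightarrow> \<bar>(deriv ^^ l) x t\<bar> \<le> B l"
    by metis
  have "bdd_above (?M ` {- real k..real k})"
  proof (rule bdd_aboveI2)
    fix t assume "t \<in> {- real k..real k}"
    then show "?M t \<le> Max (B ` {..q})"
      using B by (auto intro!: Max.boundedI order_trans[OF B Max_ge])
  qed
  then have "Cq_seminorm q k x \<le> b \<longleftrightarrow> (\<forall>t\<in>{- real k..real k}. ?M t \<le> b)"
    unfolding Cq_seminorm_def by (subst cSUP_le_iff) auto
  also have "\<dots> \<longleftrightarrow> (\<forall>l\<le>q. \<forall>t. \<bar>t\<bar> \<le> real k \<longrightarrow> \<bar>jet x (l, t)\<bar> \<le> b)"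
    by (auto simp: jet_def abs_le_iff)
  finally show ?thesis .
qed

lemma jet_le_seminorm:
  assumes "x \<in> Cq q" "fst p \<le> q" "\<bar>snd p\<bar> \<le> real k"
  shows "\<bar>jet x p\<bar> \<le> Cq_seminorm q k x"
  using Cq_seminorm_le_iff[of x q k "Cq_seminorm q k x"] assms by (cases p) auto

lemma seminorm_le_from_taylor_data:
  assumes "x \<in> Cq q"
    and "\<And>p. p \<in> taylor_points q \<Longrightarrow> \<bar>snd p\<bar> \<le> real k \<Longrightarrow> \<bar>jet x p\<bar> \<le> b"
  shows "Cq_seminorm q k x \<le> (1 + real k) ^ q * b"
  using assms by (auto simp: Cq_seminorm_le_iff intro!: jet_bound_from_taylor_data)

lemma Cq_seminorm_nonneg: "x \<in> Cq q \<Longrightarrow> 0 \<le> Cq_seminorm q k x"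
  using jet_le_seminorm[of x q "(0, 0)" k] by simp

lemma Cq_seminorm_mono: "x \<in> Cq q \<Longrightarrow> j \<le> k \<Longrightarrow> Cq_seminorm q j x \<le> Cq_seminorm q k x"
  by (auto simp: Cq_seminorm_le_iff intro!: jet_le_seminorm)

lemma Cq_seminorm_add:
  assumes "x \<in> Cq q" "y \<in> Cq q"
  shows "Cq_seminorm q k (x + y) \<le> Cq_seminorm q k x + Cq_seminorm q k y"
proof -
  have "\<bar>jet (x + y) (l, t)\<bar> \<le> Cq_seminorm q k x + Cq_seminorm q k y"
    if "l \<le> q" "\<bar>t\<bar> \<le> real k" for l t
    using jet_le_seminorm[of x q "(l, t)" k] jet_le_seminorm[of y q "(l, t)" k] assms that
    by (simp add: jet_add)
  then show ?thesis
    using assms by (simp add: Cq_seminorm_le_iff Cq_add)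
qed

lemma Cq_seminorm_scaleR_le:
  assumes "x \<in> Cq q"
  shows "Cq_seminorm q k (c *\<^sub>R x) \<le> \<bar>c\<bar> * Cq_seminorm q k x"
  using assms
  by (auto simp: Cq_seminorm_le_iff Cq_scaleR jet_scaleR abs_mult
      intro!: mult_left_mono jet_le_seminorm)

lemma Cq_seminorm_zero: "Cq_seminorm q k 0 = 0"
  using Cq_seminorm_scaleR_le[OF zero_in_Cq, of q k 0] Cq_seminorm_nonneg[OF zero_in_Cq, of q k]
  by simp

lemma openin_Cq_ball:
  assumes "x \<in> Cq q" "0 < e"
  shows "openin (Cq_topology q) {y \<in> Cq q. Cq_seminorm q k (y - x) < e}"
  unfolding Cq_topology_def using assms by (intro topology_generated_by_Basis) blast

text \<open>The topology is given by a subbase, but the balls around a point form a base of its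
  neighborhoods: a generating ball that contains \<open>x\<close> contains one around \<open>x\<close> by the triangle
  inequality, and since the seminorms increase with \<open>k\<close>, the ball around \<open>x\<close> of index \<open>max k k'\<close>
  and radius \<open>min e e'\<close> lies in those of index \<open>k\<close>, radius \<open>e\<close> and of index \<open>k'\<close>, radius \<open>e'\<close>.\<close>

lemma openin_Cq_imp_ball:
  assumes "openin (Cq_topology q) U" "x \<in> U"
  shows "\<exists>k e. 0 < e \<and> {y \<in> Cq q. Cq_seminorm q k (y - x) < e} \<subseteq> U"
proof -
  define B where "B x k e = {y \<in> Cq q. Cq_seminorm q k (y - x) < e}" for x k e
  have "generate_topology_on {B x k e | x k e. x \<in> Cq q \<and> 0 < e} U"
    using assms(1) unfolding Cq_topology_def B_def openin_topology_generated_by_iff .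
  then have "\<forall>x\<in>U. x \<in> Cq q \<and> (\<exists>k e. 0 < e \<and> B x k e \<subseteq> U)"
  proof (induction rule: generate_topology_on.induct)
    case Empty
    then show ?case by simp
  next
    case (Int U V)
    show ?case
    proof
      fix x assume x: "x \<in> U \<inter> V"
      obtain k e where U: "x \<in> Cq q" "0 < e" "B x k e \<subseteq> U"
        using Int.IH(1) x by (meson IntD1)
      obtain k' e' where V: "0 < e'" "B x k' e' \<subseteq> V"
        using Int.IH(2) x by (meson IntD2)
      have "y \<in> B x k e \<inter> B x k' e'" if "y \<in> B x (max k k') (min e e')" for y
        using that Cq_seminorm_mono[of "y - x" q k "max k k'"]
          Cq_seminorm_mono[of "y - x" q k' "max k k'"] Cq_diff[of y q x] U(1)
        by (auto simp: B_def)
      then have "B x (max k k') (min e e') \<subseteq> U \<inter> V"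
        using U V by blast
      moreover have "0 < min e e'"
        using U V by simp
      ultimately show "x \<in> Cq q \<and> (\<exists>k e. 0 < e \<and> B x k e \<subseteq> U \<inter> V)"
        using U(1) by blast
    qed
  next
    case (UN K)
    then show ?case by (meson Union_iff Sup_upper order_trans)
  next
    case (Basis V)
    then obtain c k e where V: "V = B c k e" "c \<in> Cq q" "0 < e"
      by blast
    show ?case
    proof
      fix x assume x: "x \<in> V"
      then have xC: "x \<in> Cq q" and xe: "Cq_seminorm q k (x - c) < e"
        by (auto simp: V B_def)
      have "B x k (e - Cq_seminorm q k (x - c)) \<subseteq> V"
      proof
        fix y assume "y \<in> B x k (e - Cq_seminorm q k (x - c))"
        then have y: "y \<in> Cq q" "Cq_seminorm q k (y - x) < e - Cq_seminorm q k (x - c)"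
          by (auto simp: B_def)
        have "Cq_seminorm q k (y - c) \<le> Cq_seminorm q k (y - x) + Cq_seminorm q k (x - c)"
          using Cq_seminorm_add[of "y - x" q "x - c" k] y xC V by (simp add: Cq_diff)
        then show "y \<in> V"
          using y by (simp add: V B_def)
      qed
      then show "x \<in> Cq q \<and> (\<exists>k e. 0 < e \<and> B x k e \<subseteq> V)"
        using xe xC by (meson diff_gt_0_iff_gt)
    qed
  qed
  then show ?thesis
    using assms(2) unfolding B_def by blast
qed

lemma limitin_Cq_iff:
  assumes "range h \<subseteq> Cq q"
  shows "limitin (Cq_topology q) h h0 sequentially \<longleftrightarrow>
    h0 \<in> Cq q \<and> (\<forall>k. (\<lambda>n. Cq_seminorm q k (h n - h0)) \<longlonglongrightarrow> 0)" (is "?L \<longleftrightarrow> ?R")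
proof
  assume L: ?L
  then have h0: "h0 \<in> Cq q"
    by (simp add: limitin_def topspace_Cq_topology)
  have "(\<lambda>n. Cq_seminorm q k (h n - h0)) \<longlonglongrightarrow> 0" for k
  proof (rule tendstoI)
    fix e :: real assume e: "0 < e"
    have "\<forall>\<^sub>F n in sequentially. h n \<in> {y \<in> Cq q. Cq_seminorm q k (y - h0) < e}"
      using L openin_Cq_ball[OF h0 e, of k] h0 e by (auto simp: limitin_def Cq_seminorm_zero)
    then show "\<forall>\<^sub>F n in sequentially. dist (Cq_seminorm q k (h n - h0)) 0 < e"
      by eventually_elim (use h0 in \<open>auto simp: Cq_seminorm_nonneg Cq_diff\<close>)
  qed
  with h0 show ?R by blast
next
  assume R: ?R
  show ?L
    unfolding limitin_def topspace_Cq_topology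
  proof (intro conjI allI impI)
    fix U assume "openin (Cq_topology q) U \<and> h0 \<in> U"
    then obtain k e where ke: "0 < e" "{y \<in> Cq q. Cq_seminorm q k (y - h0) < e} \<subseteq> U"
      using openin_Cq_imp_ball[of q U] by blast
    then have "\<forall>\<^sub>F n in sequentially. Cq_seminorm q k (h n - h0) < e"
      using R by (auto intro: order_tendstoD)
    then show "\<forall>\<^sub>F n in sequentially. h n \<in> U"
      by eventually_elim (use ke assms in auto)
  qed (use R in auto)
qed

lemma tvs_bounded_Cq_iff:
  "tvs_bounded (Cq_topology q) S \<longleftrightarrow>
    S \<subseteq> Cq q \<and> (\<forall>k. \<exists>b. \<forall>x\<in>S. Cq_seminorm q k x \<le> b)" (is "?L \<longleftrightarrow> ?R")
proof
  assume L: ?L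
  have "\<exists>b. \<forall>x\<in>S. Cq_seminorm q k x \<le> b" for k
  proof -
    define V where "V = {y \<in> Cq q. Cq_seminorm q k (y - 0) < 1}"
    have "openin (Cq_topology q) V" "0 \<in> V"
      using openin_Cq_ball[OF zero_in_Cq, of 1 q k]
      by (simp_all add: V_def zero_in_Cq Cq_seminorm_zero)
    then obtain r where r: "0 < r" "\<And>c. c > r \<Longrightarrow> S \<subseteq> (\<lambda>v. c *\<^sub>R v) ` V"
      using L unfolding tvs_bounded_def by blast
    have "Cq_seminorm q k x \<le> r + 1" if "x \<in> S" for x
    proof -
      have "x \<in> (\<lambda>v. (r + 1) *\<^sub>R v) ` V"
        using r(2)[of "r + 1"] that by auto
      then obtain v where v: "v \<in> V" "x = (r + 1) *\<^sub>R v"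
        by blast
      then have "Cq_seminorm q k x \<le> \<bar>r + 1\<bar> * Cq_seminorm q k v"
        by (simp add: V_def Cq_seminorm_scaleR_le)
      also have "\<dots> \<le> \<bar>r + 1\<bar> * 1"
        using v by (intro mult_left_mono) (auto simp: V_def)
      finally show ?thesis using r by simp
    qed
    then show ?thesis by blast
  qed
  then show ?R
    using L by (auto simp: tvs_bounded_def topspace_Cq_topology)
next
  assume R: ?R
  show ?L
    unfolding tvs_bounded_def topspace_Cq_topology
  proof (intro conjI allI impI)
    fix V assume "openin (Cq_topology q) V \<and> 0 \<in> V"
    then obtain k e where ke: "0 < e" "{y \<in> Cq q. Cq_seminorm q k (y - 0) < e} \<subseteq> V"
      using openin_Cq_imp_ball[of q V] by blast
    obtain b where b: "\<And>x. x \<in> S \<Longrightarrow> Cq_seminorm q k x \<le> b"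
      using R by blast
    define r where "r = (\<bar>b\<bar> + 1) / e"
    have "S \<subseteq> (\<lambda>v. c *\<^sub>R v) ` V" if "c > r" for c
    proof
      fix x assume x: "x \<in> S"
      have "0 < r" using ke by (simp add: r_def add_nonneg_pos)
      then have c: "0 < c" using that by simp
      have "b < c * e"
        using that ke by (simp add: r_def field_simps)
      have xC: "x \<in> Cq q" using x R by auto
      have "Cq_seminorm q k (inverse c *\<^sub>R x) \<le> \<bar>inverse c\<bar> * Cq_seminorm q k x"
        by (rule Cq_seminorm_scaleR_le[OF xC])
      also have "\<dots> \<le> inverse c * b"
        using b[OF x] c by simp
      also have "\<dots> < e"
        using \<open>b < c * e\<close> c by (simp add: field_simps)
      finally have "inverse c *\<^sub>R x \<in> V"
        using ke(2) Cq_scaleR[OF xC] by auto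
      then show "x \<in> (\<lambda>v. c *\<^sub>R v) ` V"
        using c by (intro image_eqI[of _ _ "inverse c *\<^sub>R x"]) auto
    qed
    moreover have "0 < r" using ke by (simp add: r_def add_nonneg_pos)
    ultimately show "\<exists>r>0. \<forall>c>r. S \<subseteq> (\<lambda>v. c *\<^sub>R v) ` V" by blast
  qed (use R in auto)
qed

section \<open>The chain rule\<close>

lemma open_zero_sum_split:
  fixes V :: "'a::topological_ab_group_add set"
  assumes "open V" "0 \<in> V"
  obtains W where "open W" "0 \<in> W" "\<And>a b. a \<in> W \<Longrightarrow> b \<in> W \<Longrightarrow> a + b \<in> V"
proof -
  have "LIM p (nhds (0::'a) \<times>\<^sub>F nhds 0). fst p + snd p :> nhds (0 + 0)"
    by (rule tendsto_add_Pair)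
  then have "\<forall>\<^sub>F p in nhds (0::'a) \<times>\<^sub>F nhds 0. fst p + snd p \<in> V"
    using assms by (auto simp: tendsto_def)
  then obtain P Q where PQ: "\<forall>\<^sub>F a in nhds (0::'a). P a" "\<forall>\<^sub>F b in nhds (0::'a). Q b"
    "\<And>a b. P a \<Longrightarrow> Q b \<Longrightarrow> a + b \<in> V"
    unfolding eventually_prod_filter by auto
  obtain W1 W2 where "open W1" "0 \<in> W1" "\<And>a. a \<in> W1 \<Longrightarrow> P a" "open W2" "0 \<in> W2" "\<And>a. a \<in> W2 \<Longrightarrow> Q a"
    using PQ(1,2) unfolding eventually_nhds by blast
  then show thesis
    using PQ(3) by (intro that[of "W1 \<inter> W2"]) auto
qed

text \<open>The derivative of a map of \<open>X = topspace T\<close> into itself is a continuous linear operator whose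
  target carries a topology \<open>T\<close> that need not come from a type class.\<close>

definition linear_endomorphism :: "'a::real_vector topology \<Rightarrow> ('a \<Rightarrow> 'a) \<Rightarrow> bool" where
  "linear_endomorphism T A \<longleftrightarrow>
     continuous_map T T A \<and>
     (\<forall>x\<in>topspace T. \<forall>y\<in>topspace T. A (x + y) = A x + A y) \<and>
     (\<forall>c. \<forall>x\<in>topspace T. A (c *\<^sub>R x) = c *\<^sub>R A x)"

definition diff_quotient :: "('a::real_vector \<Rightarrow> 'a) \<Rightarrow> 'a \<Rightarrow> real \<Rightarrow> 'a \<Rightarrow> 'a" where
  "diff_quotient H x t h = (H (x + t *\<^sub>R h) - H x) /\<^sub>R t"

lemma step_diff_quotient: "t \<noteq> 0 \<Longrightarrow> H x + t *\<^sub>R diff_quotient H x t h = H (x + t *\<^sub>R h)"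
  by (simp add: diff_quotient_def)

lemma diff_quotient_in_subspace:
  assumes "subspace X" "\<And>y. y \<in> X \<Longrightarrow> H y \<in> X" "x \<in> X" "h \<in> X"
  shows "diff_quotient H x t h \<in> X"
  unfolding diff_quotient_def using assms
  by (intro subspace_scale subspace_diff) (auto intro: subspace_add subspace_scale)

lemma linear_endomorphism_in: "linear_endomorphism T A \<Longrightarrow> h \<in> topspace T \<Longrightarrow> A h \<in> topspace T"
  by (auto simp: linear_endomorphism_def continuous_map_def)

lemma continuous_linear_operator_compose:
  assumes "continuous_linear_operator T B" "linear_endomorphism T A"
  shows "continuous_linear_operator T (B \<circ> A)"
  using assms linear_endomorphism_in[OF assms(2)]
  by (auto simp: continuous_linear_operator_def linear_endomorphism_def
      intro: continuous_map_compose)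

lemma continuous_linear_operator_diff:
  assumes "subspace (topspace T)" "continuous_linear_operator T B" "x \<in> topspace T" "y \<in> topspace T"
  shows "B (x - y) = B x - B y"
proof -
  have "B (x - y + y) = B (x - y) + B y"
    using assms subspace_diff[of "topspace T" x y] unfolding continuous_linear_operator_def by blast
  then show ?thesis by simp
qed

text \<open>The chain rule. With \<open>k = diff_quotient H x t h\<close>, the increment of \<open>f \<circ> H\<close> is the increment
  of \<open>f\<close> from \<open>H x\<close> to \<open>H x + t k\<close>. As \<open>h\<close> ranges over a bounded set, so does \<open>k\<close>, hence the remainder of
  \<open>f\<close> tends to \<open>0\<close> uniformly; and \<open>B k - B (A h) = B (k - A h)\<close> tends to \<open>0\<close> uniformly by continuity of \<open>B\<close>
  at \<open>0\<close>. Requiring boundedness of all difference quotients is more than bounded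
  differentiability of \<open>H\<close> at \<open>x\<close> provides; it holds for Lipschitz maps and keeps the argument
  free of sequences.\<close>

lemma bounded_differentiable_at_compose:
  fixes T :: "'a::real_vector topology" and f :: "'a \<rightharpoonup> 'b::real_tvs"
  assumes X: "subspace (topspace T)"
    and H: "\<And>y. y \<in> topspace T \<Longrightarrow> H y \<in> topspace T"
    and x: "x \<in> topspace T"
    and A: "linear_endomorphism T A"
    and bdd: "\<And>S. tvs_bounded T S \<Longrightarrow>
      tvs_bounded T {diff_quotient H x t h | t h. t \<noteq> 0 \<and> h \<in> S}"
    and lim: "\<And>S V. tvs_bounded T S \<Longrightarrow> openin T V \<Longrightarrow> 0 \<in> V \<Longrightarrow>
      \<forall>\<^sub>F t in at 0. \<forall>h\<in>S. diff_quotient H x t h - A h \<in> V"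
    and F: "\<And>y. y \<in> topspace T \<Longrightarrow> F y = f (H y)"
    and f: "bounded_differentiable_at T f (H x)"
  shows "bounded_differentiable_at T F x"
proof -
  obtain B where B: "continuous_linear_operator T B"
    and rem: "\<And>S V. tvs_bounded T S \<Longrightarrow> open V \<Longrightarrow> 0 \<in> V \<Longrightarrow> \<forall>\<^sub>F t::real in at 0. \<forall>h\<in>S.
       (the (f (H x + t *\<^sub>R h)) - the (f (H x)) - t *\<^sub>R B h) /\<^sub>R t \<in> V"
    using f unfolding bounded_differentiable_at_def by blast
  have "\<forall>\<^sub>F t::real in at 0. \<forall>h\<in>S.
      (the (F (x + t *\<^sub>R h)) - the (F x) - t *\<^sub>R (B \<circ> A) h) /\<^sub>R t \<in> V"
    if S: "tvs_bounded T S" and V: "open V" "0 \<in> V" for S V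
  proof -
    have SX: "S \<subseteq> topspace T"
      using S by (simp add: tvs_bounded_def)
    obtain W where W: "open W" "0 \<in> W" "\<And>a b. a \<in> W \<Longrightarrow> b \<in> W \<Longrightarrow> a + b \<in> V"
      using open_zero_sum_split V by metis
    define U where "U = {h \<in> topspace T. B h \<in> W}"
    have "openin T U"
      using B W unfolding U_def continuous_linear_operator_def
      by (intro openin_continuous_map_preimage[of T euclidean]) auto
    moreover have "0 \<in> U"
    proof -
      have "B (0 *\<^sub>R x) = 0 *\<^sub>R B x"
        using B x unfolding continuous_linear_operator_def by blast
      then show ?thesis
        using W X by (simp add: U_def subspace_0)
    qed
    ultimately have 1: "\<forall>\<^sub>F t in at 0. \<forall>h\<in>S. diff_quotient H x t h - A h \<in> U"
      using lim S by blast
    have 2: "\<forall>\<^sub>F t in at 0. \<forall>k\<in>{diff_quotient H x t h | t h. t \<noteq> 0 \<and> h \<in> S}.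
        (the (f (H x + t *\<^sub>R k)) - the (f (H x)) - t *\<^sub>R B k) /\<^sub>R t \<in> W"
      using rem[OF bdd[OF S] W(1,2)] .
    have 3: "\<forall>\<^sub>F t::real in at 0. t \<noteq> 0"
      by (simp add: eventually_at_filter)
    show ?thesis
      using 1 2 3
    proof eventually_elim
      case (elim t)
      show ?case
      proof
        fix h assume h: "h \<in> S"
        define k where "k = diff_quotient H x t h"
        have hX: "h \<in> topspace T" "x + t *\<^sub>R h \<in> topspace T"
          using h SX X x by (auto intro: subspace_add subspace_scale)
        then have kX: "k \<in> topspace T" "A h \<in> topspace T"
          using X H x A unfolding k_def
          by (auto intro: diff_quotient_in_subspace linear_endomorphism_in)
        have "(the (f (H x + t *\<^sub>R k)) - the (f (H x)) - t *\<^sub>R B k) /\<^sub>R t \<in> W"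
          using elim h unfolding k_def by blast
        moreover have "B k - B (A h) \<in> W"
          using elim h kX continuous_linear_operator_diff[OF X B] by (auto simp: U_def k_def)
        ultimately have "(the (f (H x + t *\<^sub>R k)) - the (f (H x)) - t *\<^sub>R B k) /\<^sub>R t
            + (B k - B (A h)) \<in> V"
          by (rule W(3))
        also have "H x + t *\<^sub>R k = H (x + t *\<^sub>R h)"
          using elim by (simp add: k_def step_diff_quotient)
        also have "(the (f (H (x + t *\<^sub>R h))) - the (f (H x)) - t *\<^sub>R B k) /\<^sub>R t + (B k - B (A h))
            = (the (F (x + t *\<^sub>R h)) - the (F x) - t *\<^sub>R (B \<circ> A) h) /\<^sub>R t"
          using elim hX x by (simp add: F scaleR_diff_right)
        finally show "(the (F (x + t *\<^sub>R h)) - the (F x) - t *\<^sub>R (B \<circ> A) h) /\<^sub>R t \<in> V" .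
      qed
    qed
  qed
  then show ?thesis
    unfolding bounded_differentiable_at_def
    using continuous_linear_operator_compose[OF B A] by blast
qed

text \<open>For Hadamard differentiability the directions \<open>h n\<close> are simply replaced by the difference
  quotients of \<open>H\<close>, which converge to \<open>A h0\<close>. Where \<open>t n = 0\<close> there is no difference quotient;
  any direction leads to the same point there, and \<open>A h0\<close> is chosen to keep the sequence
  convergent.\<close>

lemma compact_differentiable_at_compose:
  fixes T :: "'a::real_vector topology" and f :: "'a \<rightharpoonup> 'b::real_tvs"
  assumes X: "subspace (topspace T)"
    and H: "\<And>y. y \<in> topspace T \<Longrightarrow> H y \<in> topspace T"
    and x: "x \<in> topspace T"
    and A: "linear_endomorphism T A"
    and lim: "\<And>t h h0. t \<longlonglongrightarrow> 0 \<Longrightarrow> range h \<subseteq> topspace T \<Longrightarrow> limitin T h h0 sequentially \<Longrightarrow>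
      limitin T (\<lambda>n. if t n = 0 then A h0 else diff_quotient H x (t n) (h n)) (A h0) sequentially"
    and F: "\<And>y. y \<in> topspace T \<Longrightarrow> F y = f (H y)"
    and f: "compact_differentiable_at T f (H x)"
  shows "compact_differentiable_at T F x"
proof -
  obtain B where B: "continuous_linear_operator T B"
    and rem: "\<And>t h h0. t \<longlonglongrightarrow> 0 \<Longrightarrow> range h \<subseteq> topspace T \<Longrightarrow> limitin T h h0 sequentially \<Longrightarrow>
      (\<lambda>n. (the (f (H x + t n *\<^sub>R h n)) - the (f (H x)) - t n *\<^sub>R B h0) /\<^sub>R t n) \<longlonglongrightarrow> 0"
    using f unfolding compact_differentiable_at_def by blast
  have "(\<lambda>n. (the (F (x + t n *\<^sub>R h n)) - the (F x) - t n *\<^sub>R (B \<circ> A) h0) /\<^sub>R t n) \<longlonglongrightarrow> 0"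
    if t: "t \<longlonglongrightarrow> 0" and h: "range h \<subseteq> topspace T" and h0: "limitin T h h0 sequentially"
    for t :: "nat \<Rightarrow> real" and h h0
  proof -
    define k where "k n = (if t n = 0 then A h0 else diff_quotient H x (t n) (h n))" for n
    have "h0 \<in> topspace T"
      using h0 by (simp add: limitin_def)
    moreover have "h n \<in> topspace T" for n
      using h by auto
    ultimately have "k n \<in> topspace T" for n
      using diff_quotient_in_subspace[OF X H x, of _ "h n" "t n"] linear_endomorphism_in[OF A]
      by (simp add: k_def)
    then have "(\<lambda>n. (the (f (H x + t n *\<^sub>R k n)) - the (f (H x)) - t n *\<^sub>R B (A h0)) /\<^sub>R t n) \<longlonglongrightarrow> 0"
      using lim[OF t h h0, folded k_def] by (intro rem[OF t]) auto
    moreover have "f (H x + t n *\<^sub>R k n) = F (x + t n *\<^sub>R h n)" for n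
    proof -
      have "x + t n *\<^sub>R h n \<in> topspace T"
        using x h X by (auto intro: subspace_add subspace_scale)
      then show ?thesis
        using x by (cases "t n = 0") (auto simp: k_def F step_diff_quotient)
    qed
    ultimately show ?thesis
      using x by (simp add: F)
  qed
  then show ?thesis
    unfolding compact_differentiable_at_def
    using continuous_linear_operator_compose[OF B A] by blast
qed


section \<open>Truncation in \<open>C\<^sup>q\<close>\<close>

text \<open>The function \<open>u \<mapsto> u + \<theta> u\<close> has the trapezoidal derivative \<open>p\<close>, which is \<open>1\<close> on \<open>[-d, d]\<close>, falls
  linearly to \<open>0\<close> on \<open>d \<le> \<bar>u\<bar> \<le> 2 d\<close> and vanishes beyond. So it is the identity on \<open>[-d, d]\<close> and
  constant outside \<open>[-2 d, 2 d]\<close>, and the slope \<open>1 / d\<close> of the flanks is the Lipschitz constant behind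
  the quadratic remainder.\<close>

lemma cutoff_exists:
  fixes d :: real
  assumes d: "0 < d"
  obtains \<theta> \<theta>' :: "real \<Rightarrow> real" where
    "continuous_on UNIV \<theta>" "continuous_on UNIV \<theta>'"
    "\<And>u. \<bar>u\<bar> \<le> d \<Longrightarrow> \<theta> u = 0" "\<And>u. \<bar>u + \<theta> u\<bar> \<le> 2 * d" "\<And>u. \<bar>\<theta>' u\<bar> \<le> 1"
    "\<And>u v. \<bar>\<theta> u - \<theta> v\<bar> \<le> \<bar>u - v\<bar>"
    "\<And>u v. \<bar>\<theta> u - \<theta> v - \<theta>' v * (u - v)\<bar> \<le> (u - v)\<^sup>2 / d"
proof -
  define p where "p u = max 0 (min 1 (2 - \<bar>u\<bar> / d))" for u
  define \<theta>' where "\<theta>' u = p u - 1" for u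
  have cont': "continuous_on UNIV \<theta>'"
    unfolding \<theta>'_def p_def using d by (intro continuous_intros) auto
  then obtain \<theta> where \<theta>: "\<And>u. (\<theta> has_real_derivative \<theta>' u) (at u)" "\<theta> 0 = 0"
    using continuous_antiderivative[of \<theta>' 0] by blast
  have p01: "0 \<le> p u" "p u \<le> 1" for u
    by (auto simp: p_def)
  have lip: "\<bar>\<theta>' u - \<theta>' v\<bar> \<le> \<bar>u - v\<bar> / d" for u v
  proof -
    have "\<bar>\<theta>' u - \<theta>' v\<bar> \<le> \<bar>\<bar>u\<bar> / d - \<bar>v\<bar> / d\<bar>"
      by (auto simp: \<theta>'_def p_def max_def min_def abs_if)
    also have "\<dots> = \<bar>\<bar>u\<bar> - \<bar>v\<bar>\<bar> / d"
      using d by (simp flip: diff_divide_distrib)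
    also have "\<dots> \<le> \<bar>u - v\<bar> / d"
      using d by (intro divide_right_mono) auto
    finally show ?thesis .
  qed
  \<comment> \<open>The mean value inequality for \<open>\<theta>\<close> minus a linear function: \<open>c = 0\<close> gives Lipschitz bounds
    and flatness, \<open>c = \<theta>' v\<close> the remainder, and \<open>c = - 1\<close> statements on \<open>u + \<theta> u\<close>.\<close>
  have mvt: "\<bar>(\<theta> u - c * u) - (\<theta> v - c * v)\<bar> \<le> b * \<bar>u - v\<bar>"
    if "\<And>s. min u v \<le> s \<Longrightarrow> s \<le> max u v \<Longrightarrow> \<bar>\<theta>' s - c\<bar> \<le> b" for b c u v
  proof -
    have "norm ((\<theta> u - c * u) - (\<theta> v - c * v)) \<le> b * norm (u - v)"
    proof (rule field_differentiable_bound[where S = "{min u v..max u v}"])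
      show "((\<lambda>s. \<theta> s - c * s) has_real_derivative \<theta>' s - c) (at s within {min u v..max u v})" for s
        by (auto intro!: derivative_eq_intros has_field_derivative_at_within[OF \<theta>(1)])
    qed (use that in auto)
    then show ?thesis by simp
  qed
  show thesis
  proof (rule that[of \<theta> \<theta>'])
    show "continuous_on UNIV \<theta>"
      using \<theta>(1) by (meson DERIV_isCont continuous_at_imp_continuous_on)
    show "\<theta> u = 0" if "\<bar>u\<bar> \<le> d" for u
    proof -
      have "\<bar>\<theta>' s - 0\<bar> \<le> 0" if "min u 0 \<le> s" "s \<le> max u 0" for s
      proof -
        have "\<bar>s\<bar> / d \<le> 1"
          using that \<open>\<bar>u\<bar> \<le> d\<close> d by (auto simp: min_def max_def split: if_splits)
        then show ?thesis by (simp add: \<theta>'_def p_def)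
      qed
      then show ?thesis
        using mvt[of u 0 0 0] \<theta>(2) by simp
    qed
    show "\<bar>\<theta>' u\<bar> \<le> 1" for u
      using p01[of u] by (simp add: \<theta>'_def)
    then show "\<bar>\<theta> u - \<theta> v\<bar> \<le> \<bar>u - v\<bar>" for u v
      using mvt[of u v 0 1] by simp
    show "\<bar>\<theta> u - \<theta> v - \<theta>' v * (u - v)\<bar> \<le> (u - v)\<^sup>2 / d" for u v
    proof -
      have "\<bar>\<theta>' s - \<theta>' v\<bar> \<le> \<bar>u - v\<bar> / d" if "min u v \<le> s" "s \<le> max u v" for s
      proof -
        have "\<bar>s - v\<bar> / d \<le> \<bar>u - v\<bar> / d"
          using that d by (intro divide_right_mono) auto
        then show ?thesis using lip[of s v] by linarith
      qed
      from mvt[of u v "\<theta>' v", OF this] show ?thesis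
        by (simp add: algebra_simps power2_eq_square flip: abs_mult)
    qed
    show "\<bar>u + \<theta> u\<bar> \<le> 2 * d" for u
    proof -
      \<comment> \<open>Between \<open>u\<close> and its projection \<open>v\<close> to \<open>[-2 d, 2 d]\<close> the map \<open>u + \<theta> u\<close> is constant.\<close>
      define v where "v = max (- (2 * d)) (min (2 * d) u)"
      have "\<bar>\<theta>' s - (- 1)\<bar> \<le> 0" if "min u v \<le> s" "s \<le> max u v" "u \<noteq> v" for s
      proof -
        have "2 * d \<le> \<bar>s\<bar>"
          using that d by (auto simp: v_def min_def max_def split: if_splits)
        then have "2 \<le> \<bar>s\<bar> / d"
          using d by (simp add: field_simps)
        then show ?thesis by (simp add: \<theta>'_def p_def)
      qed
      then have "u + \<theta> u = v + \<theta> v"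
        using mvt[of u v "- 1" 0] by (cases "u = v") auto
      moreover have "\<bar>v + \<theta> v\<bar> \<le> \<bar>v\<bar>"
        using mvt[of v 0 "- 1" 1] \<theta>(2) p01 by (simp add: \<theta>'_def add.commute)
      moreover have "\<bar>v\<bar> \<le> 2 * d"
        using d by (auto simp: v_def)
      ultimately show ?thesis by linarith
    qed
  qed (rule cont')
qed

definition Cq_of_taylor_data :: "nat \<Rightarrow> (nat \<times> real \<Rightarrow> real) \<Rightarrow> real \<Rightarrow> real" where
  "Cq_of_taylor_data q w = (THE z. z \<in> Cq q \<and> (\<forall>p\<in>taylor_points q. jet z p = w p))"

lemma Cq_of_taylor_data:
  assumes "continuous_on UNIV (\<lambda>t. w (q, t))"
  shows "Cq_of_taylor_data q w \<in> Cq q"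
    and "p \<in> taylor_points q \<Longrightarrow> jet (Cq_of_taylor_data q w) p = w p"
proof -
  have "\<exists>!z. z \<in> Cq q \<and> (\<forall>p\<in>taylor_points q. jet z p = w p)"
    using Cq_exists_with_taylor_data[OF assms] Cq_eqI[of _ q] by metis
  from theI'[OF this]
  show "Cq_of_taylor_data q w \<in> Cq q"
    and "p \<in> taylor_points q \<Longrightarrow> jet (Cq_of_taylor_data q w) p = w p"
    unfolding Cq_of_taylor_data_def by auto
qed

text \<open>The projection to \<open>[-k, k]\<close> fixes \<open>0\<close>, so on \<^term>\<open>taylor_points q\<close> it affects only the top
  derivative.\<close>

definition clamp_point :: "nat \<Rightarrow> nat \<times> real \<Rightarrow> nat \<times> real" where
  "clamp_point k p = (fst p, max (- real k) (min (real k) (snd p)))"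

lemma fst_clamp_point [simp]: "fst (clamp_point k p) = fst p"
  by (simp add: clamp_point_def)

lemma abs_snd_clamp_point_le: "\<bar>snd (clamp_point k p)\<bar> \<le> \<bar>snd p\<bar>" "\<bar>snd (clamp_point k p)\<bar> \<le> real k"
  by (auto simp: clamp_point_def max_def min_def)

lemma clamp_point_id: "\<bar>snd p\<bar> \<le> real k \<Longrightarrow> clamp_point k p = p"
  by (cases p) (auto simp: clamp_point_def)

lemma continuous_jet_clamp_point:
  assumes "x \<in> Cq q"
  shows "continuous_on UNIV (\<lambda>t. jet x (clamp_point k (q, t)))"
proof -
  have "continuous_on UNIV (\<lambda>t. (deriv ^^ q) x (max (- real k) (min (real k) t)))"
    by (rule continuous_on_compose2[OF Cq_continuous_deriv[OF assms order_refl]])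
      (auto intro!: continuous_intros)
  then show ?thesis by (simp add: jet_def clamp_point_def)
qed

lemma continuous_jet: "x \<in> Cq q \<Longrightarrow> continuous_on UNIV (\<lambda>t. jet x (q, t))"
  using Cq_continuous_deriv[of x q q UNIV] by (simp add: jet_def)

text \<open>The parameter \<open>k\<close> is the index of the seminorm that is to be kept small, and \<open>u + \<theta> u\<close> is the
  truncation of a real number \<open>u\<close>.\<close>

locale cutoff =
  fixes q k :: nat and d :: real and \<theta> \<theta>' :: "real \<Rightarrow> real"
  assumes d_pos: "0 < d"
    and continuous: "continuous_on UNIV \<theta>" and continuous': "continuous_on UNIV \<theta>'"
    and vanishes: "\<bar>u\<bar> \<le> d \<Longrightarrow> \<theta> u = 0"
    and truncates: "\<bar>u + \<theta> u\<bar> \<le> 2 * d"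
    and bounded': "\<bar>\<theta>' u\<bar> \<le> 1"
    and lipschitz: "\<bar>\<theta> u - \<theta> v\<bar> \<le> \<bar>u - v\<bar>"
    and remainder: "\<bar>\<theta> u - \<theta> v - \<theta>' v * (u - v)\<bar> \<le> (u - v)\<^sup>2 / d"
begin

definition truncate :: "(real \<Rightarrow> real) \<Rightarrow> real \<Rightarrow> real" where
  "truncate x = Cq_of_taylor_data q (\<lambda>p. jet x p + \<theta> (jet x (clamp_point k p)))"

definition truncate_deriv :: "(real \<Rightarrow> real) \<Rightarrow> (real \<Rightarrow> real) \<Rightarrow> real \<Rightarrow> real" where
  "truncate_deriv x h =
     Cq_of_taylor_data q (\<lambda>p. jet h p + \<theta>' (jet x (clamp_point k p)) * jet h (clamp_point k p))"

lemma truncate: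
  assumes "x \<in> Cq q"
  shows truncate_in_Cq: "truncate x \<in> Cq q"
    and jet_truncate: "p \<in> taylor_points q \<Longrightarrow> jet (truncate x) p = jet x p + \<theta> (jet x (clamp_point k p))"
  unfolding truncate_def using assms
  by (auto intro!: Cq_of_taylor_data continuous_intros continuous_jet continuous_jet_clamp_point
      continuous_on_compose2[OF continuous])

lemma truncate_deriv:
  assumes "x \<in> Cq q" "h \<in> Cq q"
  shows truncate_deriv_in_Cq: "truncate_deriv x h \<in> Cq q"
    and jet_truncate_deriv: "p \<in> taylor_points q \<Longrightarrow>
      jet (truncate_deriv x h) p = jet h p + \<theta>' (jet x (clamp_point k p)) * jet h (clamp_point k p)"
  unfolding truncate_deriv_def using assms
  by (auto intro!: Cq_of_taylor_data continuous_intros continuous_jet continuous_jet_clamp_point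
      continuous_on_compose2[OF continuous'])

text \<open>All arguments of \<open>\<theta>\<close> in the definition of \<^term>\<open>truncate x\<close> are values of the jet of \<open>x\<close> over \<open>[-k, k]\<close>,
  hence bounded by the seminorm of index \<open>k\<close>.\<close>

lemma truncate_eq_self:
  assumes "x \<in> Cq q" "Cq_seminorm q k x \<le> d"
  shows "truncate x = x"
proof (rule Cq_eqI[of _ q])
  fix p assume p: "p \<in> taylor_points q"
  have "\<bar>jet x (clamp_point k p)\<bar> \<le> d"
    using jet_le_seminorm[OF assms(1), of "clamp_point k p" k] assms(2) taylor_points_le[OF p]
      abs_snd_clamp_point_le[of k p] by simp
  then show "jet (truncate x) p = jet x p"
    using assms(1) p by (simp add: jet_truncate vanishes)
qed (use assms truncate_in_Cq in auto)

text \<open>Over \<open>[-k, k]\<close> clamping has no effect, so there the Taylor data of \<^term>\<open>truncate x\<close> are numbers of the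
  form \<open>u + \<theta> u\<close>.\<close>

lemma truncate_bounded:
  assumes "x \<in> Cq q"
  shows "Cq_seminorm q k (truncate x) \<le> (1 + real k) ^ q * (2 * d)"
  using assms
  by (intro seminorm_le_from_taylor_data) (auto simp: truncate_in_Cq jet_truncate clamp_point_id truncates)

text \<open>The factor \<open>2\<close> accounts for the direction itself and for its clamped copy, whose coefficient
  is at most \<open>1\<close>. Clamping never increases the distance to \<open>0\<close>, so one and the same index \<open>m\<close> occurs on both
  sides, whether or not \<open>m\<close> exceeds \<open>k\<close>.\<close>

lemma seminorm_truncate_deriv:
  assumes "x \<in> Cq q" "h \<in> Cq q"
  shows "Cq_seminorm q m (truncate_deriv x h) \<le> (1 + real m) ^ q * (2 * Cq_seminorm q m h)"
proof (rule seminorm_le_from_taylor_data)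
  fix p assume p: "p \<in> taylor_points q" "\<bar>snd p\<bar> \<le> real m"
  have "\<bar>jet h p\<bar> \<le> Cq_seminorm q m h" "\<bar>jet h (clamp_point k p)\<bar> \<le> Cq_seminorm q m h"
    using p assms taylor_points_le[OF p(1)] abs_snd_clamp_point_le[of k p]
    by (auto intro!: jet_le_seminorm)
  moreover have "\<bar>\<theta>' (jet x (clamp_point k p)) * jet h (clamp_point k p)\<bar> \<le> 1 * \<bar>jet h (clamp_point k p)\<bar>"
    unfolding abs_mult by (intro mult_right_mono bounded') auto
  ultimately show "\<bar>jet (truncate_deriv x h) p\<bar> \<le> 2 * Cq_seminorm q m h"
    using p assms by (simp add: jet_truncate_deriv)
qed (use assms truncate_deriv_in_Cq in auto)

lemma truncate_deriv_add:
  assumes "x \<in> Cq q" "g \<in> Cq q" "h \<in> Cq q"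
  shows "truncate_deriv x (g + h) = truncate_deriv x g + truncate_deriv x h"
  using assms
  by (intro Cq_eqI[of _ q])
    (auto simp: truncate_deriv_in_Cq Cq_add jet_truncate_deriv jet_add[where q = q] taylor_points_le algebra_simps)

lemma truncate_deriv_scaleR:
  assumes "x \<in> Cq q" "h \<in> Cq q"
  shows "truncate_deriv x (c *\<^sub>R h) = c *\<^sub>R truncate_deriv x h"
  using assms
  by (intro Cq_eqI[of _ q])
    (auto simp: truncate_deriv_in_Cq Cq_scaleR jet_truncate_deriv jet_scaleR[where q = q] taylor_points_le algebra_simps)

lemma diff_quotient_truncate_in_Cq:
  assumes "x \<in> Cq q" "h \<in> Cq q"
  shows "diff_quotient truncate x t h \<in> Cq q"
  using assms subspace_Cq truncate_in_Cq by (intro diff_quotient_in_subspace) auto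

lemma jet_diff_quotient_truncate:
  assumes "x \<in> Cq q" "h \<in> Cq q" "p \<in> taylor_points q" "t \<noteq> 0"
  shows "jet (diff_quotient truncate x t h) p = jet h p +
    (\<theta> (jet x (clamp_point k p) + t * jet h (clamp_point k p)) - \<theta> (jet x (clamp_point k p))) / t"
proof -
  have "jet (diff_quotient truncate x t h) p =
      inverse t * (jet (truncate (x + t *\<^sub>R h)) p - jet (truncate x) p)"
    unfolding diff_quotient_def using assms
    by (simp add: jet_scaleR[where q = q] jet_diff[where q = q] truncate_in_Cq Cq_diff Cq_add
        Cq_scaleR taylor_points_le)
  also have "\<dots> = inverse t * (t * jet h p +
      (\<theta> (jet x (clamp_point k p) + t * jet h (clamp_point k p)) - \<theta> (jet x (clamp_point k p))))"
    using assms by (simp add: jet_truncate jet_add[where q = q] jet_scaleR[where q = q] Cq_add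
        Cq_scaleR taylor_points_le)
  finally show ?thesis
    using assms(4) by (simp add: field_simps)
qed

lemma seminorm_diff_quotient_truncate:
  assumes "x \<in> Cq q" "h \<in> Cq q" "t \<noteq> 0"
  shows "Cq_seminorm q m (diff_quotient truncate x t h) \<le> (1 + real m) ^ q * (2 * Cq_seminorm q m h)"
proof (rule seminorm_le_from_taylor_data)
  fix p assume p: "p \<in> taylor_points q" "\<bar>snd p\<bar> \<le> real m"
  define a b where "a = jet x (clamp_point k p)" and "b = jet h (clamp_point k p)"
  have "\<bar>jet h p\<bar> \<le> Cq_seminorm q m h" "\<bar>b\<bar> \<le> Cq_seminorm q m h"
    using p assms taylor_points_le[OF p(1)] abs_snd_clamp_point_le[of k p]
    by (auto simp: b_def intro!: jet_le_seminorm)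
  moreover have "\<bar>(\<theta> (a + t * b) - \<theta> a) / t\<bar> \<le> \<bar>b\<bar>"
    using lipschitz[of "a + t * b" a] assms(3) by (simp add: abs_mult field_simps)
  moreover have "jet (diff_quotient truncate x t h) p = jet h p + (\<theta> (a + t * b) - \<theta> a) / t"
    using p assms by (simp add: jet_diff_quotient_truncate a_def b_def)
  ultimately show "\<bar>jet (diff_quotient truncate x t h) p\<bar> \<le> 2 * Cq_seminorm q m h"
    by linarith
qed (use assms diff_quotient_truncate_in_Cq in auto)

text \<open>The direction \<open>h\<close> itself is a summand both of the difference quotient and of the derivative and
  cancels; what remains at each Taylor point is the quadratic remainder of \<open>\<theta>\<close>, divided by \<open>t\<close>.\<close>

lemma seminorm_truncate_remainder:
  assumes "x \<in> Cq q" "h \<in> Cq q" "t \<noteq> 0"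
  shows "Cq_seminorm q m (diff_quotient truncate x t h - truncate_deriv x h)
    \<le> (1 + real m) ^ q * (\<bar>t\<bar> * (Cq_seminorm q m h)\<^sup>2 / d)"
proof (rule seminorm_le_from_taylor_data)
  fix p assume p: "p \<in> taylor_points q" "\<bar>snd p\<bar> \<le> real m"
  define a b where "a = jet x (clamp_point k p)" and "b = jet h (clamp_point k p)"
  have "\<bar>b\<bar> \<le> Cq_seminorm q m h"
    using p assms taylor_points_le[OF p(1)] abs_snd_clamp_point_le[of k p]
    by (auto simp: b_def intro!: jet_le_seminorm)
  then have "b\<^sup>2 \<le> (Cq_seminorm q m h)\<^sup>2"
    using power_mono[of "\<bar>b\<bar>" _ 2] by simp
  then have b: "\<bar>t\<bar> * b\<^sup>2 / d \<le> \<bar>t\<bar> * (Cq_seminorm q m h)\<^sup>2 / d"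
    using d_pos by (intro divide_right_mono mult_left_mono) auto
  have "\<bar>(\<theta> (a + t * b) - \<theta> a) / t - \<theta>' a * b\<bar> = \<bar>\<theta> (a + t * b) - \<theta> a - \<theta>' a * (t * b)\<bar> / \<bar>t\<bar>"
    using assms(3) by (simp add: field_simps flip: abs_divide)
  also have "\<dots> \<le> ((t * b)\<^sup>2 / d) / \<bar>t\<bar>"
    using remainder[of "a + t * b" a] by (intro divide_right_mono) auto
  also have "\<dots> = \<bar>t\<bar> * b\<^sup>2 / d"
    using assms(3) by (simp add: power2_eq_square abs_if)
  finally have "\<bar>(\<theta> (a + t * b) - \<theta> a) / t - \<theta>' a * b\<bar> \<le> \<bar>t\<bar> * b\<^sup>2 / d" .
  moreover have "jet (diff_quotient truncate x t h - truncate_deriv x h) p =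
      (\<theta> (a + t * b) - \<theta> a) / t - \<theta>' a * b"
    using p assms
    by (simp add: jet_diff_quotient_truncate jet_truncate_deriv jet_diff[where q = q]
        taylor_points_le truncate_deriv_in_Cq diff_quotient_truncate_in_Cq a_def b_def)
  ultimately show "\<bar>jet (diff_quotient truncate x t h - truncate_deriv x h) p\<bar>
      \<le> \<bar>t\<bar> * (Cq_seminorm q m h)\<^sup>2 / d"
    using b by linarith
qed (use assms diff_quotient_truncate_in_Cq truncate_deriv_in_Cq Cq_diff in auto)

lemma linear_endomorphism_truncate_deriv:
  assumes x: "x \<in> Cq q"
  shows "linear_endomorphism (Cq_topology q) (truncate_deriv x)"
proof -
  let ?T = "Cq_topology q" and ?A = "truncate_deriv x"
  have diff: "?A y - ?A h = ?A (y - h)" if "y \<in> Cq q" "h \<in> Cq q" for y h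
    using truncate_deriv_add[OF x Cq_diff[OF that] that(2)] by simp
  have "openin ?T {h \<in> topspace ?T. ?A h \<in> U}" if U: "openin ?T U" for U
  proof (subst openin_subopen, intro ballI)
    fix h assume "h \<in> {h \<in> topspace ?T. ?A h \<in> U}"
    then have h: "h \<in> Cq q" "?A h \<in> U"
      by (auto simp: topspace_Cq_topology)
    obtain m e where e: "0 < e" "{y \<in> Cq q. Cq_seminorm q m (y - ?A h) < e} \<subseteq> U"
      using openin_Cq_imp_ball[OF U h(2)] by blast
    define C where "C = 2 * (1 + real m) ^ q"
    have C: "0 < C" by (simp add: C_def)
    define W where "W = {y \<in> Cq q. Cq_seminorm q m (y - h) < e / C}"
    have "?A y \<in> U" if "y \<in> W" for y
    proof -
      have y: "y \<in> Cq q" "Cq_seminorm q m (y - h) < e / C"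
        using that by (auto simp: W_def)
      have "Cq_seminorm q m (?A y - ?A h) \<le> C * Cq_seminorm q m (y - h)"
        using seminorm_truncate_deriv[OF x Cq_diff[OF y(1) h(1)], of m] y h
        by (simp add: diff C_def mult_ac)
      also have "\<dots> < e"
        using y C by (simp add: field_simps)
      finally show ?thesis
        using e(2) truncate_deriv_in_Cq[OF x y(1)] by blast
    qed
    moreover have "openin ?T W"
      unfolding W_def using h e C by (intro openin_Cq_ball) auto
    moreover have "h \<in> W"
      using h e C by (simp add: W_def Cq_seminorm_zero)
    ultimately show "\<exists>W. openin ?T W \<and> h \<in> W \<and> W \<subseteq> {h \<in> topspace ?T. ?A h \<in> U}"
      by (intro exI[of _ W]) (auto simp: W_def topspace_Cq_topology)
  qed
  then show ?thesis
    using x unfolding linear_endomorphism_def continuous_map_def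
    by (auto simp: topspace_Cq_topology truncate_deriv_in_Cq truncate_deriv_add truncate_deriv_scaleR)
qed

text \<open>On a bounded set of directions, where \<open>\<parallel>h\<parallel>\<^sub>m \<le> b\<close>, the remainder estimate becomes the uniform
  bound \<open>O(\<bar>t\<bar> b\<^sup>2)\<close>.\<close>

lemma bounded_differentiable_at_truncate:
  assumes x: "x \<in> Cq q" and F: "\<And>y. y \<in> Cq q \<Longrightarrow> F y = f (truncate y)"
    and f: "bounded_differentiable_at (Cq_topology q) f (truncate x)"
  shows "bounded_differentiable_at (Cq_topology q) F x"
proof (rule bounded_differentiable_at_compose[where H = truncate and A = "truncate_deriv x" and f = f])
  fix S assume S: "tvs_bounded (Cq_topology q) S"
  have "\<exists>b. \<forall>y\<in>{diff_quotient truncate x t h | t h. t \<noteq> 0 \<and> h \<in> S}. Cq_seminorm q m y \<le> b" for m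
  proof -
    obtain b where b: "\<And>h. h \<in> S \<Longrightarrow> h \<in> Cq q \<and> Cq_seminorm q m h \<le> b"
      using S unfolding tvs_bounded_Cq_iff by blast
    have "Cq_seminorm q m (diff_quotient truncate x t h) \<le> (1 + real m) ^ q * (2 * b)"
      if "t \<noteq> 0" "h \<in> S" for t h
    proof (rule order_trans[OF seminorm_diff_quotient_truncate])
      show "(1 + real m) ^ q * (2 * Cq_seminorm q m h) \<le> (1 + real m) ^ q * (2 * b)"
        using b that by (intro mult_left_mono) auto
    qed (use x b that in auto)
    then show ?thesis by blast
  qed
  then show "tvs_bounded (Cq_topology q) {diff_quotient truncate x t h | t h. t \<noteq> 0 \<and> h \<in> S}"
    using S x unfolding tvs_bounded_Cq_iff by (auto intro!: diff_quotient_truncate_in_Cq)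
next
  fix S V assume S: "tvs_bounded (Cq_topology q) S" and V: "openin (Cq_topology q) V" "0 \<in> V"
  obtain m e where e: "0 < e" "{y \<in> Cq q. Cq_seminorm q m (y - 0) < e} \<subseteq> V"
    using openin_Cq_imp_ball[OF V] by blast
  obtain b where b: "\<And>h. h \<in> S \<Longrightarrow> h \<in> Cq q \<and> Cq_seminorm q m h \<le> b"
    using S unfolding tvs_bounded_Cq_iff by blast
  have "((\<lambda>t. (1 + real m) ^ q * (\<bar>t\<bar> * b\<^sup>2 / d)) \<longlongrightarrow> 0) (at 0)"
    using d_pos by (auto intro!: tendsto_eq_intros)
  then have "\<forall>\<^sub>F t in at 0. (1 + real m) ^ q * (\<bar>t\<bar> * b\<^sup>2 / d) < e"
    using e(1) by (auto dest: order_tendstoD)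
  moreover have "\<forall>\<^sub>F t::real in at 0. t \<noteq> 0"
    by (simp add: eventually_at_filter)
  ultimately show "\<forall>\<^sub>F t in at 0. \<forall>h\<in>S. diff_quotient truncate x t h - truncate_deriv x h \<in> V"
  proof eventually_elim
    case (elim t)
    show ?case
    proof
      fix h assume "h \<in> S"
      then have h: "h \<in> Cq q" "Cq_seminorm q m h \<le> b"
        using b by auto
      have "Cq_seminorm q m (diff_quotient truncate x t h - truncate_deriv x h)
          \<le> (1 + real m) ^ q * (\<bar>t\<bar> * (Cq_seminorm q m h)\<^sup>2 / d)"
        using x h elim by (intro seminorm_truncate_remainder)
      also have "\<dots> \<le> (1 + real m) ^ q * (\<bar>t\<bar> * b\<^sup>2 / d)"
        using h d_pos Cq_seminorm_nonneg[OF h(1)]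
        by (intro mult_left_mono divide_right_mono power_mono) auto
      finally have "Cq_seminorm q m (diff_quotient truncate x t h - truncate_deriv x h) < e"
        using elim by linarith
      moreover have "diff_quotient truncate x t h - truncate_deriv x h \<in> Cq q"
        using x h by (intro Cq_diff diff_quotient_truncate_in_Cq truncate_deriv_in_Cq)
      ultimately show "diff_quotient truncate x t h - truncate_deriv x h \<in> V"
        using e(2) by auto
    qed
  qed
qed (use assms subspace_Cq truncate_in_Cq linear_endomorphism_truncate_deriv in
    \<open>auto simp: topspace_Cq_topology\<close>)

text \<open>The difference quotient in direction \<open>h n\<close> is compared with the derivative in the same
  direction by the remainder estimate, and then with the derivative in direction \<open>h0\<close> by
  linearity and continuity.\<close>

lemma compact_differentiable_at_truncate:
  assumes x: "x \<in> Cq q" and F: "\<And>y. y \<in> Cq q \<Longrightarrow> F y = f (truncate y)"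
    and f: "compact_differentiable_at (Cq_topology q) f (truncate x)"
  shows "compact_differentiable_at (Cq_topology q) F x"
proof (rule compact_differentiable_at_compose[where H = truncate and A = "truncate_deriv x" and f = f])
  fix t :: "nat \<Rightarrow> real" and h :: "nat \<Rightarrow> real \<Rightarrow> real" and h0
  assume t: "t \<longlonglongrightarrow> 0" and "range h \<subseteq> topspace (Cq_topology q)"
    and lim: "limitin (Cq_topology q) h h0 sequentially"
  then have h: "range h \<subseteq> Cq q" "\<And>n. h n \<in> Cq q"
    by (auto simp: topspace_Cq_topology)
  have h0: "h0 \<in> Cq q" and s: "\<And>m. (\<lambda>n. Cq_seminorm q m (h n - h0)) \<longlonglongrightarrow> 0"
    using lim unfolding limitin_Cq_iff[OF h(1)] by auto
  let ?A = "truncate_deriv x"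
  define K where "K n = (if t n = 0 then ?A h0 else diff_quotient truncate x (t n) (h n))" for n
  have K: "K n \<in> Cq q" for n
    using x h(2) h0 by (simp add: K_def truncate_deriv_in_Cq diff_quotient_truncate_in_Cq)
  have "(\<lambda>n. Cq_seminorm q m (K n - ?A h0)) \<longlonglongrightarrow> 0" for m
  proof (rule tendsto_sandwich[of "\<lambda>_. 0"])
    let ?C = "(1 + real m) ^ q"
    let ?s = "\<lambda>n. Cq_seminorm q m (h n - h0)"
    let ?u = "\<lambda>n. ?C * (\<bar>t n\<bar> * (?s n + Cq_seminorm q m h0)\<^sup>2 / d) + ?C * (2 * ?s n)"
    show "?u \<longlonglongrightarrow> 0"
      using d_pos by (auto intro!: tendsto_eq_intros t s)
    have "Cq_seminorm q m (K n - ?A h0) \<le> ?u n" for n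
    proof (cases "t n = 0")
      case True
      then show ?thesis
        using Cq_seminorm_nonneg[OF Cq_diff[OF h(2) h0], of m n] by (simp add: K_def Cq_seminorm_zero)
    next
      case False
      have "Cq_seminorm q m (h n) \<le> ?s n + Cq_seminorm q m h0"
        using Cq_seminorm_add[OF Cq_diff[OF h(2) h0] h0, of m n] by simp
      then have "?C * (\<bar>t n\<bar> * (Cq_seminorm q m (h n))\<^sup>2 / d)
          \<le> ?C * (\<bar>t n\<bar> * (?s n + Cq_seminorm q m h0)\<^sup>2 / d)"
        using d_pos Cq_seminorm_nonneg[OF h(2), of m n]
        by (intro mult_left_mono divide_right_mono power_mono) auto
      then have 1: "Cq_seminorm q m (K n - ?A (h n)) \<le> ?C * (\<bar>t n\<bar> * (?s n + Cq_seminorm q m h0)\<^sup>2 / d)"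
        using seminorm_truncate_remainder[OF x h(2) False, of m n] False by (simp add: K_def)
      have "?A (h n) - ?A h0 = ?A (h n - h0)"
        using truncate_deriv_add[OF x Cq_diff[OF h(2) h0] h0, of n] by simp
      then have 2: "Cq_seminorm q m (?A (h n) - ?A h0) \<le> ?C * (2 * ?s n)"
        using seminorm_truncate_deriv[OF x Cq_diff[OF h(2) h0], of m n] by simp
      have "Cq_seminorm q m ((K n - ?A (h n)) + (?A (h n) - ?A h0))
          \<le> Cq_seminorm q m (K n - ?A (h n)) + Cq_seminorm q m (?A (h n) - ?A h0)"
        using K h(2) h0 x by (intro Cq_seminorm_add Cq_diff truncate_deriv_in_Cq)
      then show ?thesis
        using 1 2 by simp
    qed
    then show "\<forall>\<^sub>F n in sequentially. Cq_seminorm q m (K n - ?A h0) \<le> ?u n"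
      by simp
    show "\<forall>\<^sub>F n in sequentially. 0 \<le> Cq_seminorm q m (K n - ?A h0)"
      using K h0 x by (auto intro!: always_eventually Cq_seminorm_nonneg Cq_diff truncate_deriv_in_Cq)
  qed simp
  then have "limitin (Cq_topology q) K (?A h0) sequentially"
    using K x h0 by (subst limitin_Cq_iff) (auto simp: truncate_deriv_in_Cq)
  then show "limitin (Cq_topology q)
      (\<lambda>n. if t n = 0 then ?A h0 else diff_quotient truncate x (t n) (h n)) (?A h0) sequentially"
    by (simp add: K_def[abs_def])
qed (use assms subspace_Cq truncate_in_Cq linear_endomorphism_truncate_deriv in
    \<open>auto simp: topspace_Cq_topology\<close>)

end


section \<open>Global representatives\<close>

lemma germ_member_local_map:
  assumes "G \<in> germs T" "f \<in> G"
  shows "f \<in> local_maps T"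
  using assms by (auto simp: germs_def quotient_def germ_rel_def)

text \<open>Near \<open>0\<close> the composition coincides with \<open>f\<close>, and hence with any other member of the germ.\<close>

lemma global_representative_compose:
  assumes G: "G \<in> germs T" and f: "f \<in> G"
    and H: "\<And>x. x \<in> topspace T \<Longrightarrow> H x \<in> dom f"
    and W: "openin T W" "0 \<in> W" "\<And>x. x \<in> W \<Longrightarrow> H x = x"
  shows "global_representative T G (\<lambda>x. if x \<in> topspace T then f (H x) else None)"
proof -
  let ?F = "\<lambda>x. if x \<in> topspace T then f (H x) else None"
  have dom: "dom ?F = topspace T"
    using H by (auto simp: dom_def)
  have WT: "W \<subseteq> topspace T"
    using W(1) by (rule openin_subset)
  then have "?F \<in> local_maps T"
    using dom W(2) unfolding local_maps_def by (auto intro!: exI[of _ "topspace T"])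
  obtain g where g: "g \<in> local_maps T" "G = germ_rel T `` {g}"
    using G by (auto simp: germs_def elim: quotientE)
  then obtain U where U: "openin T U" "0 \<in> U" "U \<subseteq> dom g \<inter> dom f" "\<forall>x\<in>U. g x = f x"
    using f by (auto simp: germ_rel_def)
  have "openin T (U \<inter> W) \<and> 0 \<in> U \<inter> W \<and> U \<inter> W \<subseteq> dom g \<inter> dom ?F \<and> (\<forall>x\<in>U \<inter> W. g x = ?F x)"
    unfolding dom using U W WT by auto
  then have "?F \<in> G"
    using g \<open>?F \<in> local_maps T\<close> unfolding germ_rel_def by blast
  then show ?thesis
    using dom by (simp add: global_representative_def)
qed

text \<open>The map \<open>H\<close> is the truncation, with \<open>d\<close> so small that the factor \<open>(1 + k)\<^sup>q\<close> lost in passing from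
  Taylor data to the seminorm still leaves it inside the domain of \<open>f\<close>. One and the same \<open>H\<close>
  serves both notions of differentiability.\<close>

lemma Cq_germ_pullback:
  fixes f :: "(real \<Rightarrow> real) \<rightharpoonup> 'y::real_tvs"
  assumes G: "G \<in> germs (Cq_topology q)" and f: "f \<in> G"
  obtains H F where "global_representative (Cq_topology q) G F"
    "\<And>x. x \<in> Cq q \<Longrightarrow> H x \<in> dom f"
    "\<And>x. x \<in> Cq q \<Longrightarrow> bounded_differentiable_at (Cq_topology q) f (H x) \<Longrightarrow>
       bounded_differentiable_at (Cq_topology q) F x"
    "\<And>x. x \<in> Cq q \<Longrightarrow> compact_differentiable_at (Cq_topology q) f (H x) \<Longrightarrow>
       compact_differentiable_at (Cq_topology q) F x"
proof -
  obtain U where U: "openin (Cq_topology q) U" "0 \<in> U" "U \<subseteq> dom f"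
    using germ_member_local_map[OF G f] by (auto simp: local_maps_def)
  obtain k e where e: "0 < e" "{y \<in> Cq q. Cq_seminorm q k (y - 0) < e} \<subseteq> U"
    using openin_Cq_imp_ball[OF U(1,2)] by blast
  define d where "d = e / (4 * (1 + real k) ^ q)"
  have d: "0 < d" "(1 + real k) ^ q * (2 * d) < e"
    using e(1) by (auto simp: d_def)
  obtain \<theta> \<theta>' where "cutoff d \<theta> \<theta>'"
    using cutoff_exists[OF d(1)] d(1) unfolding cutoff_def by metis
  then interpret cutoff q k d \<theta> \<theta>' .
  let ?F = "\<lambda>x. if x \<in> topspace (Cq_topology q) then f (truncate x) else None"
  have dom: "truncate x \<in> dom f" if "x \<in> Cq q" for x
    using truncate_bounded[OF that] d(2) truncate_in_Cq[OF that] e(2) U(3) by auto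
  show thesis
  proof (rule that[of ?F truncate])
    show "global_representative (Cq_topology q) G ?F"
    proof (rule global_representative_compose[OF G f])
      show "openin (Cq_topology q) {y \<in> Cq q. Cq_seminorm q k (y - 0) < d}"
        using d(1) zero_in_Cq by (rule openin_Cq_ball[rotated])
    qed (use d(1) dom in \<open>auto simp: topspace_Cq_topology zero_in_Cq Cq_seminorm_zero truncate_eq_self\<close>)
    show "bounded_differentiable_at (Cq_topology q) ?F x"
      if "x \<in> Cq q" "bounded_differentiable_at (Cq_topology q) f (truncate x)" for x
      using that
        by (auto simp: topspace_Cq_topology
            intro: bounded_differentiable_at_truncate[OF that(1) _ that(2)])
    show "compact_differentiable_at (Cq_topology q) ?F x"
      if "x \<in> Cq q" "compact_differentiable_at (Cq_topology q) f (truncate x)" for x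
      using that
        by (auto simp: topspace_Cq_topology
            intro: compact_differentiable_at_truncate[OF that(1) _ that(2)])
  qed (rule dom)
qed

theorem corollary3p8:
  fixes q :: nat
  shows "(\<forall>G \<in> (germs (Cq_topology q) :: ((real \<Rightarrow> real) \<rightharpoonup> 'y::real_tvs) set set).
            bounded_differentiable_germ (Cq_topology q) G \<longrightarrow>
            (\<exists>f. global_representative (Cq_topology q) G f \<and>
                 (\<forall>x \<in> topspace (Cq_topology q). bounded_differentiable_at (Cq_topology q) f x))) \<and>
         (\<forall>G \<in> (germs (Cq_topology q) :: ((real \<Rightarrow> real) \<rightharpoonup> 'y::real_tvs) set set).
            compact_differentiable_germ (Cq_topology q) G \<longrightarrow>
            (\<exists>f. global_representative (Cq_topology q) G f \<and>
                 (\<forall>x \<in> topspace (Cq_topology q). compact_differentiable_at (Cq_topology q) f x)))"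
proof (intro conjI ballI impI)
  fix G :: "((real \<Rightarrow> real) \<rightharpoonup> 'y) set"
  assume G: "G \<in> germs (Cq_topology q)"
  show "\<exists>f. global_representative (Cq_topology q) G f \<and>
      (\<forall>x \<in> topspace (Cq_topology q). bounded_differentiable_at (Cq_topology q) f x)"
    if "bounded_differentiable_germ (Cq_topology q) G"
  proof -
    obtain f where f: "f \<in> G" "\<forall>x\<in>dom f. bounded_differentiable_at (Cq_topology q) f x"
      using \<open>bounded_differentiable_germ _ G\<close> by (auto simp: bounded_differentiable_germ_def)
    show ?thesis
      by (rule Cq_germ_pullback[OF G f(1)]) (use f(2) in \<open>metis topspace_Cq_topology\<close>)
  qed
  show "\<exists>f. global_representative (Cq_topology q) G f \<and>
      (\<forall>x \<in> topspace (Cq_topology q). compact_differentiable_at (Cq_topology q) f x)"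
    if "compact_differentiable_germ (Cq_topology q) G"
  proof -
    obtain f where f: "f \<in> G" "\<forall>x\<in>dom f. compact_differentiable_at (Cq_topology q) f x"
      using \<open>compact_differentiable_germ _ G\<close> by (auto simp: compact_differentiable_germ_def)
    show ?thesis
      by (rule Cq_germ_pullback[OF G f(1)]) (use f(2) in \<open>metis topspace_Cq_topology\<close>)
  qed
qed

end
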